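(* Let $I\subseteq\mathbb{R}$ be a nonempty open interval, let $f:I\to\mathbb{R}$ be a continuous and strictly increasing function, and let $\alpha:(f(I)-f(I))\to\mathbb{R}_+$ be a Borel measurable even function. Let $(\xi_n)_{n\in\mathbb{N}}$ be a sequence of exchangeable random variables with values in $I$, and let $L:I\to\mathbb{R}$ be a function such that $L\circ f^{-1}:f(I)\to\mathbb{R}$ is strongly $\alpha$-convex and $\mathbb{E}(|L(\xi_1)|)<\infty$. Then the following assertions hold. (i) For each $n\in\mathbb{N}\setminus\{1\}$, we have $\mathbb{E}\big(L(\mathscr{A}_n^{f}(\xi_1,\ldots,\xi_n))\big)\in[-\infty,\infty)$ and $$\mathbb{E}\big(L(\mathscr{A}_n^{f}(\xi_1,\ldots,\xi_n))\big)\leq \mathbb{E}\big(L(\mathscr{A}_{n-1}^{f}(\xi_1,\ldots,\xi_{n-1}))\big)-\mathbb{E}\left(\alpha\left(\frac{1}{n(n-1)}\sum_{i=1}^{n-1}f(\xi_i)-\frac{1}{n}f(\xi_n)\right)\right).$$ (ii) The sequence $\Big(\mathbb{E}\big(L(\mathscr{A}_n^{f}(\xi_1,\ldots,\xi_n))\big)\Big)_{n\in\mathbb{N}}$ is decreasing. (iii) If, in addition, (1) $\mathbb{D}^2(f(\xi_1))\in(0,\infty)$, (2) $\operatorname{Cov}(f(\xi_1),f(\xi_2))\leq 0$, (3) $\alpha$ is strictly convex, (4) $\mathbb{E}\big(\alpha\big(\tfrac12(f(\xi_1)-f(\xi_2))\big)\big)<\infty$, (5) $\mathbb{E}\big(L(\mathscr{A}_n^{f}(\xi_1,\ldots,\xi_n))\big)>-\infty$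 for all $n\in\mathbb{N}$, then the sequence $\Big(\mathbb{E}\big(L(\mathscr{A}_n^{f}(\xi_1,\ldots,\xi_n))\big)\Big)_{n\in\mathbb{N}}$ is strictly decreasing.
   Context: $\mathbb{N}$ is the set of positive integers and $\mathbb{R}_+=[0,\infty)$. For a nondegenerate interval $J\subseteq\mathbb{R}$, $J-J:=\{x-y: x,y\in J\}$. Quasi-arithmetic mean: for a nonempty open interval $I$, a continuous strictly increasing $f:I\to\mathbb{R}$ with inverse $f^{-1}:f(I)\to I$, and $n\in\mathbb{N}$, $\mathscr{A}_n^{f}:I^n\to I$ is $\mathscr{A}_n^{f}(x_1,\ldots,x_n):=f^{-1}\big(\frac1n\sum_{i=1}^n f(x_i)\big)$. Strong $\alpha$-convexity: let $J\subseteq\mathbb{R}$ be a nondegenerate interval and $\alpha:(J-J)\to\mathbb{R}_+$ an even function. A function $\Lambda:J\to\mathbb{R}$ is strongly $\alpha$-convex if $\Lambda(tx+(1-t)y)\leq t\Lambda(x)+(1-t)\Lambda(y)-t\,\alpha((1-t)(x-y))-(1-t)\,\alpha(t(y-x))$ for all $x,y\in J$ and $t\in[0,1]$. Exchangeability: a sequence $(\xi_n)_{n\in\mathbb{N}}$ of random variables is exchangeable if for every $n\in\mathbb{N}$ and every permutation $\sigma$ of $(1,\ldots,n)$ the law of $(\xi_{\sigma(1)},\ldots,\xi_{\sigma(n)})$ equals that of $(\xi_1,\ldots,\xi_n)$. $\mathbb{D}^2$ denotes variance and $\operatorname{Cov}$ covariance. "Decreasing" means non-increasing (with values in $[-\infty,\infty)$).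 An expectation is said to lie in $[-\infty,\infty)$ when the positive part is integrable, the expectation being $-\infty$ if the negative part is not integrable; the expectation of a nonnegative random variable lies in $[0,\infty]$. On the right-hand side of the inequality in (i), the difference of an element of $[-\infty,\infty)$ and an element of $[0,\infty]$ is understood in the usual extended sense (in particular $-\infty-\infty=-\infty$). *)

theory Defs
  imports "HOL-Probability.Probability"
begin

definition diff_set :: "real set \<Rightarrow> real set" where
  "diff_set J = {x - y | x y. x \<in> J \<and> y \<in> J}"

text \<open>The \<open>n\<close> arguments of the mean are \<open>x 1, \<dots>, x n\<close>; \<open>x 0\<close> is not used.\<close>

definition quasi_arith_mean ::
  "real set \<Rightarrow> (real \<Rightarrow> real) \<Rightarrow> nat \<Rightarrow> (nat \<Rightarrow> real) \<Rightarrow> real" where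
  "quasi_arith_mean I f n x = the_inv_into I f ((1 / real n) * (\<Sum>i = 1..n. f (x i)))"

definition strongly_convex_on ::
  "real set \<Rightarrow> (real \<Rightarrow> real) \<Rightarrow> (real \<Rightarrow> real) \<Rightarrow> bool" where
  "strongly_convex_on J \<alpha> \<Lambda> \<longleftrightarrow>
     (\<forall>x\<in>J. \<forall>y\<in>J. \<forall>t\<in>{0..1}.
        \<Lambda> (t * x + (1 - t) * y) \<le> t * \<Lambda> x + (1 - t) * \<Lambda> y
          - t * \<alpha> ((1 - t) * (x - y)) - (1 - t) * \<alpha> (t * (y - x)))"

definition strictly_convex_on :: "real set \<Rightarrow> (real \<Rightarrow> real) \<Rightarrow> bool" where
  "strictly_convex_on S g \<longleftrightarrow> convex S \<and>
     (\<forall>x\<in>S. \<forall>y\<in>S. \<forall>t\<in>{0<..<1}.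
        x \<noteq> y \<longrightarrow> g (t * x + (1 - t) * y) < t * g x + (1 - t) * g y)"

text \<open>Sequences of random variables are indexed by the positive integers: only
  \<open>\<xi> n\<close> with \<open>n \<ge> 1\<close> matters.\<close>

definition exchangeable :: "'a measure \<Rightarrow> (nat \<Rightarrow> 'a \<Rightarrow> real) \<Rightarrow> bool" where
  "exchangeable M \<xi> \<longleftrightarrow>
     (\<forall>n\<ge>1. \<xi> n \<in> borel_measurable M) \<and>
     (\<forall>n\<ge>1. \<forall>\<sigma>. \<sigma> permutes {1..n} \<longrightarrow>
        distr M (\<Pi>\<^sub>M i\<in>{1..n}. borel) (\<lambda>\<omega>. \<lambda>i\<in>{1..n}. \<xi> (\<sigma> i) \<omega>) =
        distr M (\<Pi>\<^sub>M i\<in>{1..n}. borel) (\<lambda>\<omega>. \<lambda>i\<in>{1..n}. \<xi> i \<omega>))"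

text \<open>The extended expectation is the difference of the integrals of the positive and of
  the negative part (\<open>ennreal\<close> maps negative reals to \<open>0\<close>). It is meaningful under
  \<open>expectation_below_infinity\<close>, which says that it lies in \<open>[-\<infinity>, \<infinity>)\<close>.\<close>

definition ext_expectation :: "'a measure \<Rightarrow> ('a \<Rightarrow> real) \<Rightarrow> ereal" where
  "ext_expectation M X =
     enn2ereal (\<integral>\<^sup>+\<omega>. ennreal (X \<omega>) \<partial>M) - enn2ereal (\<integral>\<^sup>+\<omega>. ennreal (- X \<omega>) \<partial>M)"

definition expectation_below_infinity :: "'a measure \<Rightarrow> ('a \<Rightarrow> real) \<Rightarrow> bool" where
  "expectation_below_infinity M X \<longleftrightarrow>
     X \<in> borel_measurable M \<and> integrable M (\<lambda>\<omega>. max 0 (X \<omega>))"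

definition covariance :: "'a measure \<Rightarrow> ('a \<Rightarrow> real) \<Rightarrow> ('a \<Rightarrow> real) \<Rightarrow> real" where
  "covariance M X Y =
     (\<integral>\<omega>. (X \<omega> - (\<integral>\<omega>'. X \<omega>' \<partial>M)) * (Y \<omega> - (\<integral>\<omega>'. Y \<omega>' \<partial>M)) \<partial>M)"

end

theory Submission
  imports Defs
begin

text \<open>
  Put \<open>J = f(I)\<close>, \<open>\<Lambda> = L \<circ> f\<^sup>-\<^sup>1\<close> and \<open>Y\<^sub>i = f (\<xi>\<^sub>i)\<close>. The variables \<open>Y\<^sub>i\<close> are again exchangeable,
  and the claims concern \<open>E (\<Lambda> (S\<^sub>n))\<close> for the arithmetic means \<open>S\<^sub>n = (Y\<^sub>1 + \<dots> + Y\<^sub>n) / n\<close>.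

  The idea is that \<open>S\<^sub>n\<close> is the mean of the \<open>n\<close> leave-one-out means \<open>T\<^sub>j\<close>, the mean of all \<open>Y\<^sub>i\<close>
  with \<open>i \<noteq> j\<close>, and that by exchangeability each \<open>T\<^sub>j\<close> has the law of \<open>T\<^sub>n = S\<^bsub>n-1\<^esub>\<close>. Strong
  \<open>\<alpha>\<close>-convexity yields at every point \<open>p\<close> of \<open>J\<close> a support line with a remainder,
  \<open>\<Lambda> p + a (x - p) + \<alpha> (x - p) \<le> \<Lambda> x\<close> (\<open>strongly_convex_on_support\<close>). Summing it at \<open>p = S\<^sub>n\<close>
  over the points \<open>T\<^sub>j\<close> gives

  \<open>n \<Lambda> (S\<^sub>n) + (\<Sum>j. \<alpha> (T\<^sub>j - S\<^sub>n)) \<le> (\<Sum>j. \<Lambda> (T\<^sub>j))\<close>   (\<open>leave_out_jensen\<close>).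

  Taking expectations and dividing by \<open>n\<close> yields
  \<open>E (\<Lambda> (S\<^sub>n)) \<le> E (\<Lambda> (S\<^bsub>n-1\<^esub>)) - E (\<alpha> (S\<^bsub>n-1\<^esub> - S\<^sub>n))\<close>, which is (i), and (ii) follows
  since \<open>\<alpha> \<ge> 0\<close>. Infinite values cause no trouble: positive parts are always integrable, and if
  \<open>E (\<Lambda> (S\<^sub>n))\<close> is finite, then the displayed inequality forces every other term to be integrable
  (\<open>integrable_step\<close>); if it is \<open>-\<infinity>\<close>, there is nothing to prove.

  For (iii), a strictly convex even \<open>\<alpha>\<close> with \<open>\<alpha> 0 = 0\<close> is positive away from \<open>0\<close>. If
  \<open>E (\<alpha> (S\<^bsub>n-1\<^esub> - S\<^sub>n))\<close> were zero, then by exchangeability every \<open>T\<^sub>j\<close>, and hence every \<open>Y\<^sub>j\<close> with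
  \<open>j \<le> n\<close>, would equal \<open>S\<^sub>n\<close> almost surely (\<open>AE_eq_if_expected_modulus_0\<close>). In particular
  \<open>Y\<^sub>1 = Y\<^sub>2\<close> almost surely, so that their covariance is the positive variance of \<open>Y\<^sub>1\<close>, contrary to
  the hypothesis that it is at most zero.
\<close>

section \<open>Strong convexity and a Jensen inequality with remainder\<close>

lemma strongly_convex_onD:
  assumes "strongly_convex_on J \<alpha> \<Lambda>" "x \<in> J" "y \<in> J" "0 \<le> t" "t \<le> 1"
  shows "\<Lambda> (t * x + (1 - t) * y) \<le> t * \<Lambda> x + (1 - t) * \<Lambda> y
          - t * \<alpha> ((1 - t) * (x - y)) - (1 - t) * \<alpha> (t * (y - x))"
  using assms unfolding strongly_convex_on_def by auto

lemma open_diff_set: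
  assumes "open J"
  shows "open (diff_set J)"
proof -
  have "diff_set J = (\<Union>y\<in>J. (\<lambda>x. x - y) ` J)"
    unfolding diff_set_def by auto
  then show ?thesis
    using assms by (auto intro!: open_translation_subtract)
qed

text \<open>Taking both points equal and \<open>t = 1\<close> makes the two values of \<open>\<Lambda>\<close> cancel and leaves
  \<open>\<alpha> 0 \<le> 0\<close>.\<close>

lemma strongly_convex_on_modulus_0:
  assumes "strongly_convex_on J \<alpha> \<Lambda>" "p \<in> J" "\<forall>u\<in>diff_set J. 0 \<le> \<alpha> u"
  shows "\<alpha> 0 = 0"
proof -
  have "p - p \<in> diff_set J"
    using assms(2) unfolding diff_set_def by blast
  then show ?thesis
    using strongly_convex_onD[OF assms(1,2,2), of 1] assms(3) by auto
qed

lemma strongly_convex_on_imp_convex_on: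
  assumes "strongly_convex_on J \<alpha> \<Lambda>" "convex J" "\<forall>u\<in>diff_set J. 0 \<le> \<alpha> u"
  shows "convex_on J \<Lambda>"
proof (rule convex_onI)
  fix t x y assume t: "0 < t" "t < (1::real)" and xy: "x \<in> J" "y \<in> J"
  define m where "m = (1 - t) * x + t * y"
  have "m \<in> J"
    using convexD[OF assms(2) xy, of "1 - t" t] t by (simp add: m_def)
  then have "x - m \<in> diff_set J" "y - m \<in> diff_set J"
    using xy unfolding diff_set_def by auto
  then have "0 \<le> (1 - t) * \<alpha> (x - m)" "0 \<le> t * \<alpha> (y - m)"
    using assms(3) t by auto
  moreover have "x - m = t * (x - y)" "y - m = (1 - t) * (y - x)"
    unfolding m_def by (simp_all add: algebra_simps)
  ultimately show "\<Lambda> ((1 - t) *\<^sub>R x + t *\<^sub>R y) \<le> (1 - t) * \<Lambda> x + t * \<Lambda> y"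
    using strongly_convex_onD[OF assms(1) xy, of "1 - t"] t by simp
qed (fact assms(2))

text \<open>With \<open>p = t x + (1 - t) y\<close>, the arguments of \<open>\<alpha>\<close> in the definition of strong convexity are
  \<open>x - p\<close> and \<open>y - p\<close>. For \<open>x < p < y\<close> the definition therefore says that the difference quotient
  at \<open>p\<close> of \<open>x \<mapsto> \<Lambda> x - \<alpha> (x - p)\<close>, with \<open>\<Lambda> p\<close> as the value at \<open>p\<close>, is no larger on the left of
  \<open>p\<close> than on the right of \<open>p\<close>. Any number separating the left quotients from the right ones
  is the slope of a support line that leaves room for \<open>\<alpha>\<close>.\<close>

lemma strongly_convex_on_support:
  assumes sc: "strongly_convex_on J \<alpha> \<Lambda>" and J: "open J" and p: "p \<in> J"
    and nonneg: "\<forall>u\<in>diff_set J. 0 \<le> \<alpha> u"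
  shows "\<exists>a. \<forall>x\<in>J. \<Lambda> p + a * (x - p) + \<alpha> (x - p) \<le> \<Lambda> x"
proof -
  define q where "q x = (\<Lambda> x - \<Lambda> p - \<alpha> (x - p)) / (x - p)" for x
  have slope: "q x \<le> q y" if x: "x \<in> J" "x < p" and y: "y \<in> J" "p < y" for x y
  proof -
    define t where "t = (y - p) / (y - x)"
    have 1: "1 - t = (p - x) / (y - x)"
      using x y by (simp add: t_def field_simps)
    have t: "0 \<le> t" "t \<le> 1"
      using x y by (auto simp: t_def field_simps)
    have e: "(1 - t) * (x - y) = x - p" "t * (y - x) = y - p"
      unfolding 1 using x y by (auto simp: t_def field_simps)
    have m: "t * x + (1 - t) * y = p"
      using e(2) by (simp add: algebra_simps)
    have "0 \<le> t * (\<Lambda> x - \<Lambda> p - \<alpha> (x - p)) + (1 - t) * (\<Lambda> y - \<Lambda> p - \<alpha> (y - p))"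
      using strongly_convex_onD[OF sc x(1) y(1) t] unfolding e m by (simp add: algebra_simps)
    also have "\<dots> = ((y - p) * (\<Lambda> x - \<Lambda> p - \<alpha> (x - p)) + (p - x) * (\<Lambda> y - \<Lambda> p - \<alpha> (y - p))) / (y - x)"
      unfolding 1 unfolding t_def by (simp add: add_divide_distrib)
    finally have "0 \<le> (y - p) * (\<Lambda> x - \<Lambda> p - \<alpha> (x - p)) + (p - x) * (\<Lambda> y - \<Lambda> p - \<alpha> (y - p))"
      using x y by (simp add: zero_le_divide_iff)
    moreover have q: "\<Lambda> x - \<Lambda> p - \<alpha> (x - p) = q x * (x - p)" "\<Lambda> y - \<Lambda> p - \<alpha> (y - p) = q y * (y - p)"
      using x y by (auto simp: q_def)
    ultimately have "0 \<le> (y - p) * (p - x) * (q y - q x)"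
      unfolding q by (simp add: algebra_simps)
    then show ?thesis
      using x y by (simp add: zero_le_mult_iff mult_le_0_iff)
  qed
  obtain e where e: "0 < e" "ball p e \<subseteq> J"
    using J p openE by blast
  \<comment> \<open>As \<open>J\<close> is open, both sides of \<open>p\<close> are inhabited, so the supremum below is that of a
    nonempty set bounded above.\<close>
  have ne: "p - e/2 \<in> J" "p + e/2 \<in> J"
    using e by (auto simp: dist_real_def intro!: subsetD[OF e(2)])
  define a where "a = (SUP x\<in>{x\<in>J. x < p}. q x)"
  have left: "q x \<le> a" if "x \<in> J" "x < p" for x
    unfolding a_def using that slope[OF _ _ ne(2)] e(1)
    by (intro cSUP_upper bdd_aboveI2[where M = "q (p + e/2)"]) auto
  have right: "a \<le> q y" if "y \<in> J" "p < y" for y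
    unfolding a_def using that slope e(1) ne(1)
    by (intro cSUP_least) (auto intro!: exI[of _ "p - e/2"])
  have "\<Lambda> p + a * (x - p) + \<alpha> (x - p) \<le> \<Lambda> x" if x: "x \<in> J" for x
  proof (cases x p rule: linorder_cases)
    case less
    then have "a * (x - p) \<le> q x * (x - p)"
      using left[OF x] by (intro mult_right_mono_neg) auto
    with less show ?thesis by (simp add: q_def)
  next
    case equal
    then show ?thesis
      using strongly_convex_on_modulus_0[OF sc p nonneg] by simp
  next
    case greater
    then have "a * (x - p) \<le> q x * (x - p)"
      using right[OF x] by (intro mult_right_mono) auto
    with greater show ?thesis by (simp add: q_def)
  qed
  then show ?thesis by blast
qed

text \<open>Summing the support inequality at the mean \<open>p\<close> over all points cancels the linear terms; the
  terms in \<open>\<alpha>\<close> survive as a gain over the usual Jensen inequality.\<close>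

lemma strongly_convex_on_jensen:
  assumes sc: "strongly_convex_on J \<alpha> \<Lambda>" and J: "open J"
    and nonneg: "\<forall>u\<in>diff_set J. 0 \<le> \<alpha> u"
    and p: "p \<in> J" and x: "\<And>j. j \<in> A \<Longrightarrow> x j \<in> J" and mean: "(\<Sum>j\<in>A. x j) = real (card A) * p"
  shows "real (card A) * \<Lambda> p + (\<Sum>j\<in>A. \<alpha> (x j - p)) \<le> (\<Sum>j\<in>A. \<Lambda> (x j))"
proof -
  obtain a where a: "\<And>x. x \<in> J \<Longrightarrow> \<Lambda> p + a * (x - p) + \<alpha> (x - p) \<le> \<Lambda> x"
    using strongly_convex_on_support[OF sc J p nonneg] by blast
  have "(\<Sum>j\<in>A. \<Lambda> p + a * (x j - p) + \<alpha> (x j - p)) \<le> (\<Sum>j\<in>A. \<Lambda> (x j))"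
    using a x by (intro sum_mono) auto
  moreover have "(\<Sum>j\<in>A. a * (x j - p)) = 0"
    by (simp add: mean sum_subtractf flip: sum_distrib_left)
  ultimately show ?thesis
    by (simp add: sum.distrib)
qed

section \<open>Equality of laws and exchangeability\<close>

text \<open>Functions measurable on a Borel set only are replaced by globally measurable ones whenever
  they have to act on a law on the whole line.\<close>

lemma borel_measurable_extend_by_0:
  fixes g :: "real \<Rightarrow> real"
  assumes "J \<in> sets borel" "g \<in> borel_measurable (restrict_space borel J)"
  shows "(\<lambda>x. if x \<in> J then g x else 0) \<in> borel_measurable borel"
  using assms by (subst measurable_If_restrict_space_iff) auto

lemma borel_measurable_compose_restrict:
  fixes g :: "real \<Rightarrow> real"
  assumes "g \<in> borel_measurable (restrict_space borel J)"
    and "X \<in> borel_measurable M" "\<And>\<omega>. \<omega> \<in> space M \<Longrightarrow> X \<omega> \<in> J"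
  shows "(\<lambda>\<omega>. g (X \<omega>)) \<in> borel_measurable M"
  by (rule measurable_compose[OF measurable_restrict_space2 assms(1)]) (use assms in auto)

lemma same_law_compose:
  fixes g :: "real \<Rightarrow> real"
  assumes J: "J \<in> sets borel" and g: "g \<in> borel_measurable (restrict_space borel J)"
    and X: "X \<in> borel_measurable M" "\<And>\<omega>. \<omega> \<in> space M \<Longrightarrow> X \<omega> \<in> J"
    and Y: "Y \<in> borel_measurable M" "\<And>\<omega>. \<omega> \<in> space M \<Longrightarrow> Y \<omega> \<in> J"
    and eq: "distr M borel X = distr M borel Y"
  shows "distr M borel (\<lambda>\<omega>. g (X \<omega>)) = distr M borel (\<lambda>\<omega>. g (Y \<omega>))"
proof -
  define h where "h x = (if x \<in> J then g x else 0)" for x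
  have h: "h \<in> borel_measurable borel"
    unfolding h_def by (rule borel_measurable_extend_by_0[OF J g])
  have *: "distr M borel (\<lambda>\<omega>. g (Z \<omega>)) = distr (distr M borel Z) borel h"
    if "Z \<in> borel_measurable M" "\<And>\<omega>. \<omega> \<in> space M \<Longrightarrow> Z \<omega> \<in> J" for Z
    using that by (subst distr_distr[OF h]) (auto simp: h_def intro!: distr_cong)
  show ?thesis
    using *[OF X] *[OF Y] eq by simp
qed

lemma same_law_integral:
  fixes U V :: "'a \<Rightarrow> real"
  assumes "U \<in> borel_measurable M" "V \<in> borel_measurable M"
    and "distr M borel U = distr M borel V"
  shows "integrable M U \<longleftrightarrow> integrable M V" "(\<integral>\<omega>. U \<omega> \<partial>M) = (\<integral>\<omega>. V \<omega> \<partial>M)"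
proof -
  show "integrable M U \<longleftrightarrow> integrable M V"
    using integrable_distr_eq[OF assms(1), of "\<lambda>x. x"] integrable_distr_eq[OF assms(2), of "\<lambda>x. x"]
      assms(3) by simp
  show "(\<integral>\<omega>. U \<omega> \<partial>M) = (\<integral>\<omega>. V \<omega> \<partial>M)"
    using integral_distr[OF assms(1), of "\<lambda>x. x"] integral_distr[OF assms(2), of "\<lambda>x. x"]
      assms(3) by simp
qed

lemma exchangeable_measurable:
  "exchangeable M X \<Longrightarrow> 1 \<le> n \<Longrightarrow> X n \<in> borel_measurable M"
  unfolding exchangeable_def by blast

lemma exchangeable_law:
  "exchangeable M X \<Longrightarrow> 1 \<le> n \<Longrightarrow> \<sigma> permutes {1..n} \<Longrightarrow>
    distr M (\<Pi>\<^sub>M i\<in>{1..n}. borel) (\<lambda>\<omega>. \<lambda>i\<in>{1..n}. X (\<sigma> i) \<omega>) =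
    distr M (\<Pi>\<^sub>M i\<in>{1..n}. borel) (\<lambda>\<omega>. \<lambda>i\<in>{1..n}. X i \<omega>)"
  unfolding exchangeable_def by blast

text \<open>Applying \<open>g\<close> to every coordinate commutes with permuting the coordinates, so the joint laws
  before and after a permutation are the images of equal laws under the same map.\<close>

lemma exchangeable_compose:
  fixes g :: "real \<Rightarrow> real"
  assumes ex: "exchangeable M X" and J: "J \<in> sets borel"
    and g: "g \<in> borel_measurable (restrict_space borel J)"
    and XJ: "\<And>n \<omega>. 1 \<le> n \<Longrightarrow> \<omega> \<in> space M \<Longrightarrow> X n \<omega> \<in> J"
  shows "exchangeable M (\<lambda>n \<omega>. g (X n \<omega>))"
  unfolding exchangeable_def
proof (intro conjI allI impI)
  fix n :: nat assume "1 \<le> n"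
  then show "(\<lambda>\<omega>. g (X n \<omega>)) \<in> borel_measurable M"
    using exchangeable_measurable[OF ex] XJ by (intro borel_measurable_compose_restrict[OF g]) auto
next
  fix n :: nat and \<sigma> assume n: "1 \<le> n" and \<sigma>: "\<sigma> permutes {1..n}"
  define h where "h x = (if x \<in> J then g x else 0)" for x
  have [measurable]: "h \<in> borel_measurable borel"
    unfolding h_def by (rule borel_measurable_extend_by_0[OF J g])
  let ?P = "\<Pi>\<^sub>M i\<in>{1..n}. (borel :: real measure)"
  let ?H = "\<lambda>x. \<lambda>i\<in>{1..n}. h (x i)"
  have H: "?H \<in> measurable ?P ?P"
    by measurable
  have *: "distr M ?P (\<lambda>\<omega>. \<lambda>i\<in>{1..n}. g (X (\<tau> i) \<omega>)) = distr (distr M ?P (\<lambda>\<omega>. \<lambda>i\<in>{1..n}. X (\<tau> i) \<omega>)) ?P ?H"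
    if "\<tau> permutes {1..n}" for \<tau>
  proof -
    have \<tau>: "\<tau> i \<ge> 1" if "i \<in> {1..n}" for i
      using permutes_in_image[OF \<open>\<tau> permutes {1..n}\<close>, of i] that by auto
    have "(\<lambda>\<omega>. \<lambda>i\<in>{1..n}. X (\<tau> i) \<omega>) \<in> measurable M ?P"
      using exchangeable_measurable[OF ex] \<tau> by (intro measurable_restrict) auto
    then show ?thesis
      using \<tau> XJ by (subst distr_distr[OF H]) (auto simp: h_def fun_eq_iff intro!: distr_cong)
  qed
  show "distr M ?P (\<lambda>\<omega>. \<lambda>i\<in>{1..n}. g (X (\<sigma> i) \<omega>)) = distr M ?P (\<lambda>\<omega>. \<lambda>i\<in>{1..n}. g (X i \<omega>))"
    using *[OF \<sigma>] *[OF permutes_id] exchangeable_law[OF ex n \<sigma>] by simp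
qed

text \<open>A linear form of finitely many of the variables is a measurable function of the vector of these
  variables, and so its law is determined by the law of that vector.\<close>

lemma exchangeable_linear_form_law:
  assumes ex: "exchangeable M X" and n: "1 \<le> n" and \<sigma>: "\<sigma> permutes {1..n}"
  shows "distr M borel (\<lambda>\<omega>. \<Sum>i=1..n. c i * X (\<sigma> i) \<omega>) = distr M borel (\<lambda>\<omega>. \<Sum>i=1..n. c i * X i \<omega>)"
proof -
  let ?P = "\<Pi>\<^sub>M i\<in>{1..n}. (borel :: real measure)"
  have *: "distr M borel (\<lambda>\<omega>. \<Sum>i=1..n. c i * X (\<tau> i) \<omega>) =
      distr (distr M ?P (\<lambda>\<omega>. \<lambda>i\<in>{1..n}. X (\<tau> i) \<omega>)) borel (\<lambda>x. \<Sum>i=1..n. c i * x i)"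
    if "\<tau> permutes {1..n}" for \<tau>
  proof -
    have \<tau>: "\<tau> i \<ge> 1" if "i \<in> {1..n}" for i
      using permutes_in_image[OF \<open>\<tau> permutes {1..n}\<close>, of i] that by auto
    have "(\<lambda>\<omega>. \<lambda>i\<in>{1..n}. X (\<tau> i) \<omega>) \<in> measurable M ?P"
      using exchangeable_measurable[OF ex] \<tau> by (intro measurable_restrict) auto
    then show ?thesis
      by (subst distr_distr) (auto simp: comp_def)
  qed
  show ?thesis
    using *[OF \<sigma>] *[OF permutes_id] exchangeable_law[OF ex n \<sigma>] by simp
qed

section \<open>Extended expectations\<close>

lemma ext_expectation_integrable:
  assumes "integrable M X"
  shows "ext_expectation M X = ereal (\<integral>\<omega>. X \<omega> \<partial>M)"
proof -
  have *: "(\<integral>\<^sup>+\<omega>. ennreal (Z \<omega>) \<partial>M) = ennreal (\<integral>\<omega>. max 0 (Z \<omega>) \<partial>M)" if "integrable M Z" for Z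
  proof -
    have "(\<integral>\<^sup>+\<omega>. ennreal (Z \<omega>) \<partial>M) = (\<integral>\<^sup>+\<omega>. ennreal (max 0 (Z \<omega>)) \<partial>M)"
      by (simp add: max_def ennreal_neg cong: if_cong) (auto intro!: nn_integral_cong simp: ennreal_neg)
    also have "\<dots> = ennreal (\<integral>\<omega>. max 0 (Z \<omega>) \<partial>M)"
      using that by (intro nn_integral_eq_integral) auto
    finally show ?thesis .
  qed
  have "(\<integral>\<omega>. max 0 (X \<omega>) \<partial>M) - (\<integral>\<omega>. max 0 (- X \<omega>) \<partial>M) = (\<integral>\<omega>. max 0 (X \<omega>) - max 0 (- X \<omega>) \<partial>M)"
    using assms by (intro Bochner_Integration.integral_diff[symmetric]) auto
  also have "(\<lambda>\<omega>. max 0 (X \<omega>) - max 0 (- X \<omega>)) = X"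
    by (auto simp: fun_eq_iff max_def)
  finally show ?thesis
    using assms unfolding ext_expectation_def
    by (simp add: *)
qed

text \<open>If the positive part is integrable, the only way to fail integrability is a negative part of
  infinite integral. Inequalities between extended expectations thus reduce to real integrals,
  except when the left-hand side is \<open>-\<infinity>\<close> and nothing has to be shown.\<close>

lemma ext_expectation_not_integrable:
  assumes below: "expectation_below_infinity M X" and not: "\<not> integrable M X"
  shows "ext_expectation M X = - \<infinity>"
proof -
  have [measurable]: "X \<in> borel_measurable M" and pos: "integrable M (\<lambda>\<omega>. max 0 (X \<omega>))"
    using below unfolding expectation_below_infinity_def by auto
  have "(\<integral>\<^sup>+\<omega>. ennreal (X \<omega>) \<partial>M) = (\<integral>\<^sup>+\<omega>. ennreal (max 0 (X \<omega>)) \<partial>M)"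
    by (auto intro!: nn_integral_cong simp: max_def ennreal_neg)
  also have "\<dots> < \<infinity>"
    using pos by (simp add: integrable_iff_bounded)
  finally have fin: "(\<integral>\<^sup>+\<omega>. ennreal (X \<omega>) \<partial>M) < \<infinity>" .
  have "(\<integral>\<^sup>+\<omega>. ennreal (- X \<omega>) \<partial>M) = \<infinity>"
    using not fin by (auto simp: real_integrable_def)
  moreover have "enn2ereal (\<integral>\<^sup>+\<omega>. ennreal (X \<omega>) \<partial>M) \<noteq> \<infinity>"
    using fin by auto
  ultimately show ?thesis
    unfolding ext_expectation_def by (cases "enn2ereal (\<integral>\<^sup>+\<omega>. ennreal (X \<omega>) \<partial>M)") auto
qed

section \<open>Arithmetic means of exchangeable variables\<close>

text \<open>This is the situation after the substitution \<open>Y\<^sub>i = f (\<xi>\<^sub>i)\<close>, \<open>J = f(I)\<close>,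
  \<open>\<Lambda> = L \<circ> f\<^sup>-\<^sup>1\<close>: the quasi-arithmetic means become images of arithmetic means, since
  \<open>L (\<A>\<^sub>n\<^sup>f(\<xi>\<^sub>1, \<dots>, \<xi>\<^sub>n)) = \<Lambda> ((Y\<^sub>1 + \<dots> + Y\<^sub>n) / n)\<close>.\<close>

locale strongly_convex_exchangeable = prob_space M
  for M :: "'a measure" +
  fixes J :: "real set" and \<alpha> \<Lambda> :: "real \<Rightarrow> real" and Y :: "nat \<Rightarrow> 'a \<Rightarrow> real"
  assumes open_J: "open J" and convex_J: "convex J"
    and modulus_measurable: "\<alpha> \<in> borel_measurable (restrict_space borel (diff_set J))"
    and modulus_nonneg: "\<forall>u\<in>diff_set J. 0 \<le> \<alpha> u"
    and strongly_convex: "strongly_convex_on J \<alpha> \<Lambda>"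
    and exchangeable_Y: "exchangeable M Y"
    and Y_in_J: "1 \<le> n \<Longrightarrow> \<omega> \<in> space M \<Longrightarrow> Y n \<omega> \<in> J"
    and integrable_Y1: "integrable M (\<lambda>\<omega>. \<Lambda> (Y 1 \<omega>))"
begin

definition partial_mean :: "nat \<Rightarrow> 'a \<Rightarrow> real" where
  "partial_mean n \<omega> = 1 / real n * (\<Sum>i = 1..n. Y i \<omega>)"

definition leave_out_mean :: "nat \<Rightarrow> nat \<Rightarrow> 'a \<Rightarrow> real" where
  "leave_out_mean n j \<omega> = 1 / (real n - 1) * (\<Sum>i\<in>{1..n} - {j}. Y i \<omega>)"

lemma Y_measurable: "1 \<le> n \<Longrightarrow> Y n \<in> borel_measurable M"
  using exchangeable_measurable[OF exchangeable_Y] .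

text \<open>A convex function on an open interval is continuous.\<close>

lemma convex_function_measurable: "\<Lambda> \<in> borel_measurable (restrict_space borel J)"
  by (intro borel_measurable_continuous_on_restrict convex_on_continuous open_J
      strongly_convex_on_imp_convex_on[OF strongly_convex convex_J modulus_nonneg])

lemma mean_in_J:
  assumes "finite A" "A \<noteq> {}" "\<And>i. i \<in> A \<Longrightarrow> 1 \<le> i" "\<omega> \<in> space M"
  shows "1 / real (card A) * (\<Sum>i\<in>A. Y i \<omega>) \<in> J"
proof -
  have "(\<Sum>i\<in>A. (1 / real (card A)) *\<^sub>R Y i \<omega>) \<in> J"
    using assms Y_in_J convex_J by (intro convex_sum) auto
  then show ?thesis
    by (simp add: sum_divide_distrib)
qed

lemma partial_mean_in_J: "1 \<le> n \<Longrightarrow> \<omega> \<in> space M \<Longrightarrow> partial_mean n \<omega> \<in> J"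
  using mean_in_J[of "{1..n}" \<omega>] by (simp add: partial_mean_def)

lemma leave_out_mean_in_J:
  assumes "2 \<le> n" "j \<in> {1..n}" "\<omega> \<in> space M"
  shows "leave_out_mean n j \<omega> \<in> J"
proof -
  have c: "card ({1..n} - {j}) = n - 1"
    using assms by simp
  then have "{1..n} - {j} \<noteq> {}"
    using assms by (metis card.empty diff_is_0_eq not_less_eq_eq numeral_2_eq_2 One_nat_def)
  then show ?thesis
    using mean_in_J[of "{1..n} - {j}" \<omega>] assms c by (simp add: leave_out_mean_def of_nat_diff)
qed

lemma partial_mean_measurable [measurable]: "partial_mean n \<in> borel_measurable M"
  unfolding partial_mean_def using Y_measurable by measurable

lemma leave_out_mean_measurable [measurable]: "leave_out_mean n j \<in> borel_measurable M"
  unfolding leave_out_mean_def using Y_measurable by measurable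

lemma leave_out_mean_last:
  assumes "2 \<le> n"
  shows "leave_out_mean n n = partial_mean (n - 1)"
proof -
  have "{1..n} - {n} = {1..n - 1}"
    using assms by auto
  moreover have "real (n - 1) = real n - 1"
    using assms by (simp add: of_nat_diff)
  ultimately show ?thesis
    unfolding leave_out_mean_def partial_mean_def fun_eq_iff by metis
qed

lemma leave_out_mean_eq:
  assumes "j \<in> {1..n}"
  shows "leave_out_mean n j \<omega> = (real n * partial_mean n \<omega> - Y j \<omega>) / (real n - 1)"
proof -
  have "(\<Sum>i\<in>{1..n} - {j}. Y i \<omega>) = (\<Sum>i=1..n. Y i \<omega>) - Y j \<omega>"
    using assms by (subst sum_diff1) auto
  moreover have "real n * partial_mean n \<omega> = (\<Sum>i=1..n. Y i \<omega>)"
    using assms by (simp add: partial_mean_def)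
  ultimately show ?thesis
    by (simp add: leave_out_mean_def)
qed

text \<open>Each \<open>Y i\<close> occurs in all but one of the \<open>n\<close> leave-one-out means, with weight
  \<open>1 / (n - 1)\<close>.\<close>

lemma mean_leave_out_mean:
  assumes "2 \<le> n"
  shows "(\<Sum>j=1..n. leave_out_mean n j \<omega>) = real n * partial_mean n \<omega>"
proof -
  define s where "s = real n * partial_mean n \<omega>"
  have s: "(\<Sum>j=1..n. Y j \<omega>) = s"
    using assms by (simp add: s_def partial_mean_def)
  have "(\<Sum>j=1..n. leave_out_mean n j \<omega>) = (\<Sum>j=1..n. (s - Y j \<omega>) / (real n - 1))"
    unfolding s_def by (intro sum.cong refl leave_out_mean_eq)
  also have "\<dots> = (\<Sum>j=1..n. s - Y j \<omega>) / (real n - 1)"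
    by (rule sum_divide_distrib[symmetric])
  also have "(\<Sum>j=1..n. s - Y j \<omega>) = (real n - 1) * s"
    unfolding sum_subtractf s by (simp add: left_diff_distrib)
  finally show ?thesis
    using assms by (simp add: s_def)
qed

lemma leave_out_mean_minus_partial_mean_in_diff_set:
  assumes "2 \<le> n" "j \<in> {1..n}" "\<omega> \<in> space M"
  shows "leave_out_mean n j \<omega> - partial_mean n \<omega> \<in> diff_set J"
proof -
  have "partial_mean n \<omega> \<in> J"
    using assms by (intro partial_mean_in_J) auto
  with leave_out_mean_in_J[OF assms] show ?thesis
    unfolding diff_set_def by blast
qed

text \<open>The transposition of \<open>1\<close> and \<open>j\<close> is applied to the linear form that reads off the first
  coordinate.\<close>

lemma Y_same_law:
  assumes "1 \<le> j"
  shows "distr M borel (Y j) = distr M borel (Y 1)"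
proof -
  have "distr M borel (\<lambda>\<omega>. \<Sum>i=1..j. (if i = 1 then 1 else 0) * Y (Transposition.transpose 1 j i) \<omega>)
      = distr M borel (\<lambda>\<omega>. \<Sum>i=1..j. (if i = 1 then 1 else 0) * Y i \<omega>)"
    by (intro exchangeable_linear_form_law[OF exchangeable_Y assms] permutes_swap_id) (use assms in auto)
  moreover have "(\<Sum>i=1..j. (if i = 1 then 1 else 0) * g i) = g 1" for g :: "nat \<Rightarrow> real"
    using assms by (simp add: if_distrib[of "\<lambda>x. x * _"] sum.delta cong: if_cong)
  ultimately show ?thesis
    by (simp only: transpose_apply_first)
qed

text \<open>The transposition of \<open>j\<close> and \<open>n\<close> fixes the full mean and exchanges the two leave-one-out
  means. The joint linear form is needed with \<open>(a, b) = (1, 0)\<close> for the leave-one-out mean itself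
  and with \<open>(a, b) = (1, -1)\<close> for its deviation from the full mean.\<close>

lemma leave_out_mean_same_law:
  assumes n: "2 \<le> n" and j: "j \<in> {1..n}"
  shows "distr M borel (\<lambda>\<omega>. a * leave_out_mean n j \<omega> + b * partial_mean n \<omega>) =
    distr M borel (\<lambda>\<omega>. a * leave_out_mean n n \<omega> + b * partial_mean n \<omega>)"
proof -
  define \<sigma> where "\<sigma> = Transposition.transpose j n"
  have \<sigma>: "\<sigma> permutes {1..n}"
    unfolding \<sigma>_def using j n by (intro permutes_swap_id) auto
  \<comment> \<open>The coefficients of the linear form on the right-hand side.\<close>
  define c where "c i = b / real n + (if i = n then 0 else a / (real n - 1))" for i
  have form: "a * (1 / (real n - 1) * (\<Sum>i\<in>{1..n} - {n}. g i)) + b * (1 / real n * (\<Sum>i = 1..n. g i)) = (\<Sum>i=1..n. c i * g i)"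
    for g :: "nat \<Rightarrow> real"
  proof -
    have "(\<Sum>i=1..n. c i * g i) = (\<Sum>i=1..n. (b / real n) * g i) + (\<Sum>i=1..n. (if i = n then 0 else a / (real n - 1)) * g i)"
      by (simp add: c_def distrib_right sum.distrib)
    also have "(\<Sum>i=1..n. (if i = n then 0 else a / (real n - 1)) * g i) = (\<Sum>i\<in>{1..n} - {n}. a / (real n - 1) * g i)"
      by (intro sum.mono_neutral_cong_right) auto
    finally show ?thesis
      by (simp add: sum_divide_distrib sum_distrib_left)
  qed
  have perm: "(\<Sum>i\<in>{1..n} - {n}. Y (\<sigma> i) \<omega>) = (\<Sum>i\<in>{1..n} - {j}. Y i \<omega>)" "(\<Sum>i=1..n. Y (\<sigma> i) \<omega>) = (\<Sum>i=1..n. Y i \<omega>)" for \<omega>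
  proof -
    show *: "(\<Sum>i=1..n. Y (\<sigma> i) \<omega>) = (\<Sum>i=1..n. Y i \<omega>)"
      using sum.permute[OF \<sigma>, of "\<lambda>i. Y i \<omega>"] by (simp add: comp_def)
    show "(\<Sum>i\<in>{1..n} - {n}. Y (\<sigma> i) \<omega>) = (\<Sum>i\<in>{1..n} - {j}. Y i \<omega>)"
      using * j n by (simp add: sum_diff1 \<sigma>_def)
  qed
  have "a * leave_out_mean n j \<omega> + b * partial_mean n \<omega> = (\<Sum>i=1..n. c i * Y (\<sigma> i) \<omega>)"
    "a * leave_out_mean n n \<omega> + b * partial_mean n \<omega> = (\<Sum>i=1..n. c i * Y i \<omega>)" for \<omega>
    using form[of "\<lambda>i. Y (\<sigma> i) \<omega>"] form[of "\<lambda>i. Y i \<omega>"]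
    unfolding leave_out_mean_def partial_mean_def perm by simp_all
  then show ?thesis
    using exchangeable_linear_form_law[OF exchangeable_Y _ \<sigma>, of c] n by simp
qed

text \<open>By Jensen, \<open>\<Lambda>\<close> at the mean is at most the average of the \<open>\<Lambda> (Y j)\<close>, which are integrable as
  they all have the law of \<open>\<Lambda> (Y 1)\<close>.\<close>

lemma expectation_below_infinity_mean:
  assumes n: "1 \<le> n"
  shows "expectation_below_infinity M (\<lambda>\<omega>. \<Lambda> (partial_mean n \<omega>))"
  unfolding expectation_below_infinity_def
proof
  show [measurable]: "(\<lambda>\<omega>. \<Lambda> (partial_mean n \<omega>)) \<in> borel_measurable M"
    using n partial_mean_in_J
    by (intro borel_measurable_compose_restrict[OF convex_function_measurable]) auto
  have J: "J \<in> sets borel"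
    using open_J by simp
  have int: "integrable M (\<lambda>\<omega>. \<Lambda> (Y j \<omega>))" if "j \<in> {1..n}" for j
  proof -
    have j: "1 \<le> j" using that by simp
    have meas: "(\<lambda>\<omega>. \<Lambda> (Y i \<omega>)) \<in> borel_measurable M" if "1 \<le> i" for i
      using that Y_in_J Y_measurable
      by (intro borel_measurable_compose_restrict[OF convex_function_measurable]) auto
    have "distr M borel (\<lambda>\<omega>. \<Lambda> (Y j \<omega>)) = distr M borel (\<lambda>\<omega>. \<Lambda> (Y 1 \<omega>))"
      using j Y_in_J Y_measurable Y_same_law[OF j]
      by (intro same_law_compose[OF J convex_function_measurable]) auto
    from same_law_integral(1)[OF meas meas this] j integrable_Y1 show ?thesis
      by auto
  qed
  show "integrable M (\<lambda>\<omega>. max 0 (\<Lambda> (partial_mean n \<omega>)))"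
  proof (rule Bochner_Integration.integrable_bound)
    show "integrable M (\<lambda>\<omega>. (\<Sum>j=1..n. \<Lambda> (Y j \<omega>)) / real n)"
      using int by (intro integrable_divide_zero Bochner_Integration.integrable_sum) auto
    show "AE \<omega> in M. norm (max 0 (\<Lambda> (partial_mean n \<omega>))) \<le> norm ((\<Sum>j=1..n. \<Lambda> (Y j \<omega>)) / real n)"
    proof (rule AE_I2)
      fix \<omega> assume \<omega>: "\<omega> \<in> space M"
      note S = partial_mean_in_J[OF n \<omega>]
      have "real (card {1..n}) * \<Lambda> (partial_mean n \<omega>) + (\<Sum>j=1..n. \<alpha> (Y j \<omega> - partial_mean n \<omega>)) \<le> (\<Sum>j=1..n. \<Lambda> (Y j \<omega>))"
        using n \<omega> S Y_in_J
        by (intro strongly_convex_on_jensen[OF strongly_convex open_J modulus_nonneg])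
          (auto simp: partial_mean_def)
      moreover have "0 \<le> (\<Sum>j=1..n. \<alpha> (Y j \<omega> - partial_mean n \<omega>))"
        using modulus_nonneg Y_in_J[OF _ \<omega>] S by (intro sum_nonneg) (auto simp: diff_set_def)
      ultimately have "\<Lambda> (partial_mean n \<omega>) \<le> (\<Sum>j=1..n. \<Lambda> (Y j \<omega>)) / real n"
        using n by (simp add: field_simps)
      then show "norm (max 0 (\<Lambda> (partial_mean n \<omega>))) \<le> norm ((\<Sum>j=1..n. \<Lambda> (Y j \<omega>)) / real n)"
        unfolding real_norm_def by linarith
    qed
  qed measurable
qed

context
  fixes n :: nat
  assumes n: "2 \<le> n"
begin

abbreviation deviation :: "nat \<Rightarrow> 'a \<Rightarrow> real" where
  "deviation j \<omega> \<equiv> leave_out_mean n j \<omega> - partial_mean n \<omega>"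

lemma
  assumes j: "j \<in> {1..n}"
  shows leave_out_value_measurable: "(\<lambda>\<omega>. \<Lambda> (leave_out_mean n j \<omega>)) \<in> borel_measurable M"
    and deviation_measurable: "(\<lambda>\<omega>. \<alpha> (deviation j \<omega>)) \<in> borel_measurable M"
    and leave_out_value_same_law:
      "distr M borel (\<lambda>\<omega>. \<Lambda> (leave_out_mean n j \<omega>)) = distr M borel (\<lambda>\<omega>. \<Lambda> (partial_mean (n - 1) \<omega>))"
    and deviation_same_law:
      "distr M borel (\<lambda>\<omega>. \<alpha> (deviation j \<omega>)) = distr M borel (\<lambda>\<omega>. \<alpha> (deviation n \<omega>))"
proof -
  have nn: "n \<in> {1..n}" using n by simp
  show "(\<lambda>\<omega>. \<Lambda> (leave_out_mean n j \<omega>)) \<in> borel_measurable M"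
    using leave_out_mean_in_J[OF n j]
    by (intro borel_measurable_compose_restrict[OF convex_function_measurable]) auto
  show "(\<lambda>\<omega>. \<alpha> (deviation j \<omega>)) \<in> borel_measurable M"
    using leave_out_mean_minus_partial_mean_in_diff_set[OF n j]
    by (intro borel_measurable_compose_restrict[OF modulus_measurable]) auto
  have J: "J \<in> sets borel" "diff_set J \<in> sets borel"
    using open_J open_diff_set by auto
  have "distr M borel (\<lambda>\<omega>. \<Lambda> (leave_out_mean n j \<omega>)) = distr M borel (\<lambda>\<omega>. \<Lambda> (leave_out_mean n n \<omega>))"
  proof (rule same_law_compose[OF J(1) convex_function_measurable])
    show "distr M borel (leave_out_mean n j) = distr M borel (leave_out_mean n n)"
      using leave_out_mean_same_law[OF n j, of 1 0] by (simp only: mult_1 mult_zero_left add_0_right)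
  qed (simp_all add: leave_out_mean_in_J[OF n j] leave_out_mean_in_J[OF n nn])
  then show "distr M borel (\<lambda>\<omega>. \<Lambda> (leave_out_mean n j \<omega>)) = distr M borel (\<lambda>\<omega>. \<Lambda> (partial_mean (n - 1) \<omega>))"
    by (simp add: leave_out_mean_last[OF n])
  show "distr M borel (\<lambda>\<omega>. \<alpha> (deviation j \<omega>)) = distr M borel (\<lambda>\<omega>. \<alpha> (deviation n \<omega>))"
  proof (rule same_law_compose[OF J(2) modulus_measurable])
    show "distr M borel (deviation j) = distr M borel (deviation n)"
      using leave_out_mean_same_law[OF n j, of 1 "-1"]
      by (simp only: mult_1 mult_minus1 add_uminus_conv_diff)
  qed (simp_all add: leave_out_mean_minus_partial_mean_in_diff_set[OF n j]
      leave_out_mean_minus_partial_mean_in_diff_set[OF n nn])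
qed

lemma deviation_nonneg: "j \<in> {1..n} \<Longrightarrow> \<omega> \<in> space M \<Longrightarrow> 0 \<le> \<alpha> (deviation j \<omega>)"
  using bspec[OF modulus_nonneg leave_out_mean_minus_partial_mean_in_diff_set[OF n]] .

text \<open>Jensen for the leave-one-out means, whose mean is the full mean. The pointwise inequality is
  symmetric in \<open>j\<close>; the summands only become equal after taking expectations.\<close>

lemma leave_out_jensen:
  assumes \<omega>: "\<omega> \<in> space M"
  shows "real n * \<Lambda> (partial_mean n \<omega>) + (\<Sum>j=1..n. \<alpha> (deviation j \<omega>)) \<le> (\<Sum>j=1..n. \<Lambda> (leave_out_mean n j \<omega>))"
proof -
  have "real (card {1..n}) * \<Lambda> (partial_mean n \<omega>) + (\<Sum>j=1..n. \<alpha> (deviation j \<omega>)) \<le> (\<Sum>j=1..n. \<Lambda> (leave_out_mean n j \<omega>))"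
  proof (rule strongly_convex_on_jensen[OF strongly_convex open_J modulus_nonneg])
    show "partial_mean n \<omega> \<in> J"
      using n \<omega> by (intro partial_mean_in_J) auto
  qed (simp_all add: leave_out_mean_in_J[OF n _ \<omega>] mean_leave_out_mean[OF n, simplified])
  then show ?thesis by simp
qed

text \<open>The Jensen inequality is read backwards: the positive parts of the \<open>\<Lambda> (leave_out_mean n k)\<close>
  are integrable anyway, so an integrable lower bound for their sum controls each negative part
  and each of the nonnegative terms in \<open>\<alpha>\<close>. One function \<open>B\<close> dominates everything.\<close>

lemma integrable_step:
  assumes int: "integrable M (\<lambda>\<omega>. \<Lambda> (partial_mean n \<omega>))" and j: "j \<in> {1..n}"
  shows "integrable M (\<lambda>\<omega>. \<Lambda> (leave_out_mean n j \<omega>))" "integrable M (\<lambda>\<omega>. \<alpha> (deviation j \<omega>))"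
proof -
  define B where "B \<omega> = (\<Sum>k=1..n. max 0 (\<Lambda> (leave_out_mean n k \<omega>))) + real n * \<bar>\<Lambda> (partial_mean n \<omega>)\<bar>" for \<omega>
  have pos: "integrable M (\<lambda>\<omega>. max 0 (\<Lambda> (leave_out_mean n k \<omega>)))" if k: "k \<in> {1..n}" for k
  proof -
    have below: "expectation_below_infinity M (\<lambda>\<omega>. \<Lambda> (partial_mean (n - 1) \<omega>))"
      using n by (intro expectation_below_infinity_mean) auto
    then have [measurable]: "(\<lambda>\<omega>. \<Lambda> (partial_mean (n - Suc 0) \<omega>)) \<in> borel_measurable M"
      by (simp add: expectation_below_infinity_def)
    note [measurable] = leave_out_value_measurable[OF k]
    have "distr M borel (\<lambda>\<omega>. max 0 (\<Lambda> (leave_out_mean n k \<omega>))) = distr M borel (\<lambda>\<omega>. max 0 (\<Lambda> (partial_mean (n - 1) \<omega>)))"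
      using leave_out_value_same_law[OF k]
      by (intro same_law_compose[of UNIV "max 0"]) auto
    then show ?thesis
      using same_law_integral(1)[of "\<lambda>\<omega>. max 0 (\<Lambda> (leave_out_mean n k \<omega>))" M "\<lambda>\<omega>. max 0 (\<Lambda> (partial_mean (n - 1) \<omega>))"] below
      by (simp add: expectation_below_infinity_def)
  qed
  have B: "integrable M B"
    unfolding B_def using pos int
    by (intro Bochner_Integration.integrable_add Bochner_Integration.integrable_sum
        integrable_mult_right integrable_abs) auto
  have bound: "\<bar>\<Lambda> (leave_out_mean n j \<omega>)\<bar> \<le> B \<omega> \<and> \<bar>\<alpha> (deviation j \<omega>)\<bar> \<le> B \<omega>" if \<omega>: "\<omega> \<in> space M" for \<omega>
  proof -
    let ?W = "\<lambda>k. \<Lambda> (leave_out_mean n k \<omega>)" and ?A = "\<lambda>k. \<alpha> (deviation k \<omega>)"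
    have A: "?A j \<le> (\<Sum>k=1..n. ?A k)" "0 \<le> ?A j"
      using deviation_nonneg[OF _ \<omega>] j by (auto intro!: member_le_sum)
    have W: "(\<Sum>k=1..n. ?W k) \<le> (\<Sum>k=1..n. max 0 (?W k))"
      by (intro sum_mono) auto
    have Wj: "max 0 (?W j) \<le> (\<Sum>k=1..n. max 0 (?W k))"
      using j by (intro member_le_sum) auto
    have Wj': "max 0 (?W j) - ?W j \<le> (\<Sum>k=1..n. max 0 (?W k) - ?W k)"
      using j by (intro member_le_sum) auto
    have "\<bar>real n * \<Lambda> (partial_mean n \<omega>)\<bar> = real n * \<bar>\<Lambda> (partial_mean n \<omega>)\<bar>"
      by (simp add: abs_mult)
    then show ?thesis
      using leave_out_jensen[OF \<omega>] A W Wj Wj' unfolding B_def sum_subtractf by linarith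
  qed
  show "integrable M (\<lambda>\<omega>. \<Lambda> (leave_out_mean n j \<omega>))"
    using bound leave_out_value_measurable[OF j]
    by (intro Bochner_Integration.integrable_bound[OF B] AE_I2) fastforce+
  show "integrable M (\<lambda>\<omega>. \<alpha> (deviation j \<omega>))"
    using bound deviation_measurable[OF j]
    by (intro Bochner_Integration.integrable_bound[OF B] AE_I2) fastforce+
qed

text \<open>By exchangeability, integrating the Jensen inequality gives \<open>n\<close> copies of the same
  expectation in each of the two sums.\<close>

lemma expectation_step:
  assumes int: "integrable M (\<lambda>\<omega>. \<Lambda> (partial_mean n \<omega>))"
  shows "integrable M (\<lambda>\<omega>. \<Lambda> (partial_mean (n - 1) \<omega>))"
    and "integrable M (\<lambda>\<omega>. \<alpha> (deviation n \<omega>))"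
    and "(\<integral>\<omega>. \<Lambda> (partial_mean n \<omega>) \<partial>M) \<le> (\<integral>\<omega>. \<Lambda> (partial_mean (n - 1) \<omega>) \<partial>M) - (\<integral>\<omega>. \<alpha> (deviation n \<omega>) \<partial>M)"
proof -
  have nn: "n \<in> {1..n}" using n by simp
  note step = integrable_step[OF int]
  show *: "integrable M (\<lambda>\<omega>. \<Lambda> (partial_mean (n - 1) \<omega>))"
    using step(1)[OF nn] by (simp add: leave_out_mean_last[OF n])
  show "integrable M (\<lambda>\<omega>. \<alpha> (deviation n \<omega>))"
    using step(2)[OF nn] .
  have W: "(\<integral>\<omega>. \<Lambda> (leave_out_mean n j \<omega>) \<partial>M) = (\<integral>\<omega>. \<Lambda> (partial_mean (n - 1) \<omega>) \<partial>M)" if "j \<in> {1..n}" for j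
    using leave_out_value_measurable[OF that] * leave_out_value_same_law[OF that] by (intro same_law_integral) auto
  have A: "(\<integral>\<omega>. \<alpha> (deviation j \<omega>) \<partial>M) = (\<integral>\<omega>. \<alpha> (deviation n \<omega>) \<partial>M)" if "j \<in> {1..n}" for j
    by (rule same_law_integral(2)[OF deviation_measurable[OF that] deviation_measurable[OF nn]
        deviation_same_law[OF that]])
  have "(\<integral>\<omega>. real n * \<Lambda> (partial_mean n \<omega>) + (\<Sum>j=1..n. \<alpha> (deviation j \<omega>)) \<partial>M) \<le> (\<integral>\<omega>. (\<Sum>j=1..n. \<Lambda> (leave_out_mean n j \<omega>)) \<partial>M)"
    using leave_out_jensen int step
    by (intro integral_mono Bochner_Integration.integrable_add Bochner_Integration.integrable_sum integrable_mult_right) auto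
  also have "(\<integral>\<omega>. (\<Sum>j=1..n. \<Lambda> (leave_out_mean n j \<omega>)) \<partial>M) = (\<Sum>j=1..n. (\<integral>\<omega>. \<Lambda> (leave_out_mean n j \<omega>) \<partial>M))"
    using step by (intro Bochner_Integration.integral_sum) auto
  also have "\<dots> = real n * (\<integral>\<omega>. \<Lambda> (partial_mean (n - 1) \<omega>) \<partial>M)"
    using W by simp
  also have "(\<integral>\<omega>. real n * \<Lambda> (partial_mean n \<omega>) + (\<Sum>j=1..n. \<alpha> (deviation j \<omega>)) \<partial>M) =
      (\<integral>\<omega>. real n * \<Lambda> (partial_mean n \<omega>) \<partial>M) + (\<integral>\<omega>. (\<Sum>j=1..n. \<alpha> (deviation j \<omega>)) \<partial>M)"
    using int step
    by (intro Bochner_Integration.integral_add Bochner_Integration.integrable_sum integrable_mult_right) auto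
  also have "(\<integral>\<omega>. (\<Sum>j=1..n. \<alpha> (deviation j \<omega>)) \<partial>M) = (\<Sum>j=1..n. (\<integral>\<omega>. \<alpha> (deviation j \<omega>) \<partial>M))"
    using step by (intro Bochner_Integration.integral_sum) auto
  also have "\<dots> = (\<Sum>j=1..n. (\<integral>\<omega>. \<alpha> (deviation n \<omega>) \<partial>M))"
    using A by (rule sum.cong[OF refl])
  also have "\<dots> = real n * (\<integral>\<omega>. \<alpha> (deviation n \<omega>) \<partial>M)"
    by simp
  finally have "real n * ((\<integral>\<omega>. \<Lambda> (partial_mean n \<omega>) \<partial>M) + (\<integral>\<omega>. \<alpha> (deviation n \<omega>) \<partial>M)) \<le> real n * (\<integral>\<omega>. \<Lambda> (partial_mean (n - 1) \<omega>) \<partial>M)"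
    by (simp add: distrib_left)
  then show "(\<integral>\<omega>. \<Lambda> (partial_mean n \<omega>) \<partial>M) \<le> (\<integral>\<omega>. \<Lambda> (partial_mean (n - 1) \<omega>) \<partial>M) - (\<integral>\<omega>. \<alpha> (deviation n \<omega>) \<partial>M)"
    using n by simp
qed

text \<open>Uses \<open>1 / (n - 1) - 1 / n = 1 / (n (n - 1))\<close>.\<close>

lemma deviation_last:
  "deviation n \<omega> = 1 / (real n * (real n - 1)) * (\<Sum>i = 1..n - 1. Y i \<omega>) - 1 / real n * Y n \<omega>"
proof -
  have "partial_mean n \<omega> = 1 / real n * ((\<Sum>i = 1..n - 1. Y i \<omega>) + Y n \<omega>)"
    using n by (cases n) (auto simp: partial_mean_def)
  moreover have "leave_out_mean n n \<omega> = 1 / (real n - 1) * (\<Sum>i = 1..n - 1. Y i \<omega>)"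
    using n by (simp add: leave_out_mean_last partial_mean_def of_nat_diff)
  ultimately show ?thesis
    using n by (simp add: field_simps)
qed

lemma ext_expectation_step:
  "ext_expectation M (\<lambda>\<omega>. \<Lambda> (partial_mean n \<omega>)) \<le>
     ext_expectation M (\<lambda>\<omega>. \<Lambda> (partial_mean (n - 1) \<omega>)) - enn2ereal (\<integral>\<^sup>+\<omega>. ennreal (\<alpha> (deviation n \<omega>)) \<partial>M)"
proof (cases "integrable M (\<lambda>\<omega>. \<Lambda> (partial_mean n \<omega>))")
  case True
  note step = expectation_step[OF True]
  have nn: "n \<in> {1..n}" using n by simp
  have "(\<integral>\<^sup>+\<omega>. ennreal (\<alpha> (deviation n \<omega>)) \<partial>M) = ennreal (\<integral>\<omega>. \<alpha> (deviation n \<omega>) \<partial>M)"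
    using step(2) deviation_nonneg[OF nn] by (intro nn_integral_eq_integral) auto
  moreover have "0 \<le> (\<integral>\<omega>. \<alpha> (deviation n \<omega>) \<partial>M)"
    using deviation_nonneg[OF nn] by (intro integral_nonneg_AE) auto
  ultimately show ?thesis
    using step True by (simp add: ext_expectation_integrable)
next
  case False
  then show ?thesis
    using n expectation_below_infinity_mean[of n] by (simp add: ext_expectation_not_integrable)
qed

text \<open>By exchangeability, all the deviations \<open>deviation j\<close> vanish almost surely once
  \<open>\<alpha> (deviation n)\<close> has expectation zero; but leaving out \<open>Y j\<close> preserves the mean only if
  \<open>Y j\<close> equals the mean. Hence all of \<open>Y 1, \<dots>, Y n\<close> coincide.\<close>

lemma AE_eq_if_expected_modulus_0:
  assumes int: "integrable M (\<lambda>\<omega>. \<Lambda> (partial_mean n \<omega>))"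
    and zero: "(\<integral>\<omega>. \<alpha> (deviation n \<omega>) \<partial>M) = 0"
    and pos: "\<And>u. u \<in> diff_set J \<Longrightarrow> u \<noteq> 0 \<Longrightarrow> 0 < \<alpha> u"
  shows "AE \<omega> in M. Y 1 \<omega> = Y 2 \<omega>"
proof -
  have *: "AE \<omega> in M. Y j \<omega> = partial_mean n \<omega>" if j: "j \<in> {1..n}" for j
  proof -
    have nn: "n \<in> {1..n}" using n by simp
    have "(\<integral>\<omega>. \<alpha> (deviation j \<omega>) \<partial>M) = 0"
      using same_law_integral(2)[OF deviation_measurable[OF j] deviation_measurable[OF nn]
          deviation_same_law[OF j]] zero by simp
    moreover have "AE \<omega> in M. 0 \<le> \<alpha> (deviation j \<omega>)"
      using deviation_nonneg[OF j] by auto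
    ultimately have "AE \<omega> in M. \<alpha> (deviation j \<omega>) = 0"
      using integral_nonneg_eq_0_iff_AE[OF integrable_step(2)[OF int j]] by simp
    then show ?thesis
    proof (rule AE_mp, intro AE_I2 impI)
      fix \<omega> assume \<omega>: "\<omega> \<in> space M" and 0: "\<alpha> (deviation j \<omega>) = 0"
      have "deviation j \<omega> = 0"
        using pos[OF leave_out_mean_minus_partial_mean_in_diff_set[OF n j \<omega>]] 0 by force
      then show "Y j \<omega> = partial_mean n \<omega>"
        using n unfolding leave_out_mean_eq[OF j] by (simp add: field_simps)
    qed
  qed
  from *[of 1] *[of 2] n show ?thesis
    by auto
qed

end

lemma antimono_ext_expectation:
  "antimono_on {1..} (\<lambda>n. ext_expectation M (\<lambda>\<omega>. \<Lambda> (partial_mean n \<omega>)))"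
proof (rule monotone_onI)
  let ?E = "\<lambda>n. ext_expectation M (\<lambda>\<omega>. \<Lambda> (partial_mean n \<omega>))"
  fix m n :: nat assume m: "m \<in> {1..}" and "m \<le> n"
  from \<open>m \<le> n\<close> show "?E m \<ge> ?E n"
  proof (induction rule: dec_induct)
    case (step k)
    have "?E (Suc k) \<le> ?E k - enn2ereal (\<integral>\<^sup>+\<omega>. ennreal (\<alpha> (leave_out_mean (Suc k) (Suc k) \<omega> - partial_mean (Suc k) \<omega>)) \<partial>M)"
      using ext_expectation_step[of "Suc k"] m step by simp
    also have "\<dots> \<le> ?E k"
      by (simp add: ereal_diff_le_self)
    also have "\<dots> \<le> ?E m"
      using step by simp
    finally show ?case .
  qed simp
qed

lemma strict_antimono_ext_expectation:
  assumes finite: "\<And>n. 1 \<le> n \<Longrightarrow> - \<infinity> < ext_expectation M (\<lambda>\<omega>. \<Lambda> (partial_mean n \<omega>))"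
    and pos: "\<And>u. u \<in> diff_set J \<Longrightarrow> u \<noteq> 0 \<Longrightarrow> 0 < \<alpha> u"
    and not_eq: "\<not> (AE \<omega> in M. Y 1 \<omega> = Y 2 \<omega>)"
  shows "strict_antimono_on {1..} (\<lambda>n. ext_expectation M (\<lambda>\<omega>. \<Lambda> (partial_mean n \<omega>)))"
proof -
  let ?E = "\<lambda>n. ext_expectation M (\<lambda>\<omega>. \<Lambda> (partial_mean n \<omega>))"
  have int: "integrable M (\<lambda>\<omega>. \<Lambda> (partial_mean n \<omega>))" if "1 \<le> n" for n
    using finite[OF that] ext_expectation_not_integrable[OF expectation_below_infinity_mean[OF that]] by force
  have step: "?E n < ?E (n - 1)" if n: "2 \<le> n" for n
  proof -
    have nn: "n \<in> {1..n}" and n1: "1 \<le> n" "1 \<le> n - 1" using n by auto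
    let ?e = "\<integral>\<omega>. \<alpha> (leave_out_mean n n \<omega> - partial_mean n \<omega>) \<partial>M"
    have "?e \<noteq> 0"
      using AE_eq_if_expected_modulus_0[OF n int[OF n1(1)] _ pos] not_eq by blast
    moreover have "0 \<le> ?e"
      using deviation_nonneg[OF n nn] by (intro integral_nonneg_AE) auto
    ultimately show ?thesis
      using expectation_step(3)[OF n int[OF n1(1)]] int[OF n1(1)] int[OF n1(2)]
      by (simp add: ext_expectation_integrable)
  qed
  show ?thesis
  proof (rule monotone_onI)
    fix m n :: nat assume m: "m \<in> {1..}" and "m < n"
    then have "?E n < ?E (n - 1)"
      by (intro step) auto
    also have "?E (n - 1) \<le> ?E m"
      using antimono_ext_expectation m \<open>m < n\<close> by (auto dest!: monotone_onD[of _ _ _ _ m "n - 1"])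
    finally show "?E m > ?E n" .
  qed
qed

end

section \<open>Strict decrease and the passage to quasi-arithmetic means\<close>

text \<open>The point \<open>0\<close> is the midpoint of \<open>u\<close> and \<open>-u\<close>, where \<open>\<alpha>\<close> takes equal values.\<close>

lemma strictly_convex_even_pos:
  assumes "strictly_convex_on D \<alpha>" "\<And>u. u \<in> D \<Longrightarrow> - u \<in> D" "\<forall>u\<in>D. \<alpha> (- u) = \<alpha> u" "\<alpha> 0 = 0"
    and u: "u \<in> D" "u \<noteq> 0"
  shows "0 < \<alpha> u"
proof -
  have "\<forall>t\<in>{0<..<1}. u \<noteq> - u \<longrightarrow> \<alpha> (t * u + (1 - t) * - u) < t * \<alpha> u + (1 - t) * \<alpha> (- u)"
    using assms(1) u(1) assms(2)[OF u(1)] unfolding strictly_convex_on_def by blast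
  from bspec[OF this, of "1/2"] show ?thesis
    using assms by simp
qed

lemma covariance_eq_variance_if_AE_eq:
  assumes "AE \<omega> in M. X \<omega> = Y \<omega>" "X \<in> borel_measurable M" "Y \<in> borel_measurable M"
  shows "covariance M X Y = (\<integral>\<omega>. (X \<omega> - (\<integral>\<omega>'. X \<omega>' \<partial>M))\<^sup>2 \<partial>M)"
proof -
  have "(\<integral>\<omega>. X \<omega> \<partial>M) = (\<integral>\<omega>. Y \<omega> \<partial>M)"
    using assms by (intro integral_cong_AE) auto
  then show ?thesis
    unfolding covariance_def using assms by (intro integral_cong_AE) (auto simp: power2_eq_square)
qed

theorem theorem5p1:
  fixes I :: "real set" and f \<alpha> L :: "real \<Rightarrow> real"
    and M :: "'a measure" and \<xi> :: "nat \<Rightarrow> 'a \<Rightarrow> real"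
  assumes "open I" and "is_interval I" and "I \<noteq> {}"
    and "continuous_on I f" and "strict_mono_on I f"
    and "\<alpha> \<in> borel_measurable (restrict_space borel (diff_set (f ` I)))"
    and "\<forall>u\<in>diff_set (f ` I). 0 \<le> \<alpha> u"
    and "\<forall>u\<in>diff_set (f ` I). \<alpha> (- u) = \<alpha> u"
    and "prob_space M"
    and "exchangeable M \<xi>"
    and "\<forall>n\<ge>1. \<forall>\<omega>\<in>space M. \<xi> n \<omega> \<in> I"
    and "strongly_convex_on (f ` I) \<alpha> (L \<circ> the_inv_into I f)"
    and "integrable M (\<lambda>\<omega>. L (\<xi> 1 \<omega>))"
  shows
    "(\<forall>n\<ge>2.
        expectation_below_infinity M (\<lambda>\<omega>. L (quasi_arith_mean I f n (\<lambda>i. \<xi> i \<omega>))) \<and>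
        ext_expectation M (\<lambda>\<omega>. L (quasi_arith_mean I f n (\<lambda>i. \<xi> i \<omega>)))
          \<le> ext_expectation M (\<lambda>\<omega>. L (quasi_arith_mean I f (n - 1) (\<lambda>i. \<xi> i \<omega>)))
            - enn2ereal (\<integral>\<^sup>+\<omega>. ennreal (\<alpha> (1 / (real n * (real n - 1)) * (\<Sum>i = 1..n - 1. f (\<xi> i \<omega>))
                                            - 1 / real n * f (\<xi> n \<omega>))) \<partial>M))
     \<and>
     ((\<forall>n\<ge>1. expectation_below_infinity M (\<lambda>\<omega>. L (quasi_arith_mean I f n (\<lambda>i. \<xi> i \<omega>)))) \<and>
      antimono_on {1..} (\<lambda>n. ext_expectation M (\<lambda>\<omega>. L (quasi_arith_mean I f n (\<lambda>i. \<xi> i \<omega>)))))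
     \<and>
     (integrable M (\<lambda>\<omega>. f (\<xi> 1 \<omega>)) \<and>
      integrable M (\<lambda>\<omega>. (f (\<xi> 1 \<omega>) - prob_space.expectation M (\<lambda>\<omega>'. f (\<xi> 1 \<omega>')))\<^sup>2) \<and>
      0 < prob_space.variance M (\<lambda>\<omega>. f (\<xi> 1 \<omega>)) \<and>
      covariance M (\<lambda>\<omega>. f (\<xi> 1 \<omega>)) (\<lambda>\<omega>. f (\<xi> 2 \<omega>)) \<le> 0 \<and>
      strictly_convex_on (diff_set (f ` I)) \<alpha> \<and>
      (\<integral>\<^sup>+\<omega>. ennreal (\<alpha> (1 / 2 * (f (\<xi> 1 \<omega>) - f (\<xi> 2 \<omega>)))) \<partial>M) < \<infinity> \<and>
      (\<forall>n\<ge>1. - \<infinity> < ext_expectation M (\<lambda>\<omega>. L (quasi_arith_mean I f n (\<lambda>i. \<xi> i \<omega>))))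
      \<longrightarrow>
      strict_antimono_on {1..} (\<lambda>n. ext_expectation M (\<lambda>\<omega>. L (quasi_arith_mean I f n (\<lambda>i. \<xi> i \<omega>)))))"
proof -
  interpret prob_space M by fact
  define J where "J = f ` I"
  define \<Lambda> where "\<Lambda> = L \<circ> the_inv_into I f"
  define Y where "Y i \<omega> = f (\<xi> i \<omega>)" for i \<omega>
  have inj: "inj_on f I"
    using assms(5) by (rule strict_mono_on_imp_inj_on)
  have J: "open J" "convex J"
    unfolding J_def using assms(1,2,4) inj invariance_of_domain
    by (auto simp: is_interval_connected_1 is_interval_convex_1[symmetric] intro!: connected_continuous_image)
  have f: "f \<in> borel_measurable (restrict_space borel I)"
    using assms(4) by (rule borel_measurable_continuous_on_restrict)
  have \<xi>: "\<xi> n \<omega> \<in> I" if "1 \<le> n" "\<omega> \<in> space M" for n \<omega>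
    using assms(11) that by blast
  interpret Y: strongly_convex_exchangeable M J \<alpha> \<Lambda> Y
  proof
    show "exchangeable M Y"
      unfolding Y_def using assms(1) \<xi> by (intro exchangeable_compose[OF assms(10) _ f]) auto
    show "Y n \<omega> \<in> J" if "1 \<le> n" "\<omega> \<in> space M" for n \<omega>
      using \<xi>[OF that] by (simp add: Y_def J_def)
    have "L (\<xi> 1 \<omega>) = \<Lambda> (Y 1 \<omega>)" if "\<omega> \<in> space M" for \<omega>
      using \<xi>[OF _ that] by (simp add: \<Lambda>_def Y_def the_inv_into_f_f[OF inj])
    then show "integrable M (\<lambda>\<omega>. \<Lambda> (Y 1 \<omega>))"
      using assms(13) by (simp cong: Bochner_Integration.integrable_cong)
  qed (use J assms in \<open>simp_all add: J_def \<Lambda>_def\<close>)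
  \<comment> \<open>From here on, the substitution turns quasi-arithmetic means of the \<open>\<xi> i\<close> into arithmetic means of the \<open>Y i\<close>.\<close>
  have mean: "L (quasi_arith_mean I f n (\<lambda>i. \<xi> i \<omega>)) = \<Lambda> (Y.partial_mean n \<omega>)" for n \<omega>
    by (simp add: quasi_arith_mean_def Y.partial_mean_def Y_def \<Lambda>_def)
  have dev: "1 / (real n * (real n - 1)) * (\<Sum>i = 1..n - 1. f (\<xi> i \<omega>)) - 1 / real n * f (\<xi> n \<omega>)
      = Y.leave_out_mean n n \<omega> - Y.partial_mean n \<omega>" if "2 \<le> n" for n \<omega>
    using Y.deviation_last[OF that] by (simp add: Y_def)
  have i: "\<forall>n\<ge>2. expectation_below_infinity M (\<lambda>\<omega>. \<Lambda> (Y.partial_mean n \<omega>)) \<and>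
      ext_expectation M (\<lambda>\<omega>. \<Lambda> (Y.partial_mean n \<omega>)) \<le>
      ext_expectation M (\<lambda>\<omega>. \<Lambda> (Y.partial_mean (n - 1) \<omega>)) -
      enn2ereal (\<integral>\<^sup>+\<omega>. ennreal (\<alpha> (1 / (real n * (real n - 1)) * (\<Sum>i = 1..n - 1. f (\<xi> i \<omega>))
                                            - 1 / real n * f (\<xi> n \<omega>))) \<partial>M)"
  proof (intro allI impI conjI)
    fix n :: nat assume n: "2 \<le> n"
    then show "expectation_below_infinity M (\<lambda>\<omega>. \<Lambda> (Y.partial_mean n \<omega>))"
      by (intro Y.expectation_below_infinity_mean) auto
    show "ext_expectation M (\<lambda>\<omega>. \<Lambda> (Y.partial_mean n \<omega>)) \<le>
      ext_expectation M (\<lambda>\<omega>. \<Lambda> (Y.partial_mean (n - 1) \<omega>)) -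
      enn2ereal (\<integral>\<^sup>+\<omega>. ennreal (\<alpha> (1 / (real n * (real n - 1)) * (\<Sum>i = 1..n - 1. f (\<xi> i \<omega>))
                                            - 1 / real n * f (\<xi> n \<omega>))) \<partial>M)"
      unfolding dev[OF n] by (rule Y.ext_expectation_step[OF n])
  qed
  have iii: "strict_antimono_on {1..} (\<lambda>n. ext_expectation M (\<lambda>\<omega>. \<Lambda> (Y.partial_mean n \<omega>)))"
    if var: "0 < prob_space.variance M (\<lambda>\<omega>. f (\<xi> 1 \<omega>))"
      and cov: "covariance M (\<lambda>\<omega>. f (\<xi> 1 \<omega>)) (\<lambda>\<omega>. f (\<xi> 2 \<omega>)) \<le> 0"
      and strict: "strictly_convex_on (diff_set (f ` I)) \<alpha>"
      and finite: "\<forall>n\<ge>1. - \<infinity> < ext_expectation M (\<lambda>\<omega>. \<Lambda> (Y.partial_mean n \<omega>))"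
  proof (rule Y.strict_antimono_ext_expectation)
    show "- \<infinity> < ext_expectation M (\<lambda>\<omega>. \<Lambda> (Y.partial_mean n \<omega>))" if "1 \<le> n" for n
      using finite that by blast
    obtain p where p: "p \<in> J"
      using assms(3) by (auto simp: J_def)
    have "- u \<in> diff_set J" if "u \<in> diff_set J" for u
      using that unfolding diff_set_def by (smt (verit) mem_Collect_eq)
    then show "0 < \<alpha> u" if "u \<in> diff_set J" "u \<noteq> 0" for u
      using strictly_convex_even_pos[OF strict[folded J_def] _ _ _ that] assms(8)
        strongly_convex_on_modulus_0[OF Y.strongly_convex p Y.modulus_nonneg] by (simp add: J_def)
    show "\<not> (AE \<omega> in M. Y 1 \<omega> = Y 2 \<omega>)"
    proof
      assume "AE \<omega> in M. Y 1 \<omega> = Y 2 \<omega>"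
      then have "covariance M (Y 1) (Y 2) = variance (Y 1)"
        by (rule covariance_eq_variance_if_AE_eq) (simp_all add: Y.Y_measurable)
      with var cov show False
        by (simp add: Y_def[abs_def])
    qed
  qed
  show ?thesis
    unfolding mean
    using i iii Y.expectation_below_infinity_mean Y.antimono_ext_expectation by blast
qed

end
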